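(* Let $\mathcal A=(A(i,l))_{1\le i,l\le m}$ be a pre-twisting of $K^m$ with $K^n$ such that $\operatorname{rrank}_{\mathcal A}(l)\le1$ for all $l\in\{1,\dots,m\}$. For each $l$ whose reduced rank is $1$, let $i(l)$ denote the unique index $i(l)\neq l$ such that $A(i(l),l)\ne0$. Then there exists a twisting map $\chi\colon K^m\otimes K^n\to K^n\otimes K^m$ with $\mathcal A_\chi=\mathcal A$ if and only if for each $l\in\{1,\dots,m\}$ such that $\operatorname{rrank}_{\mathcal A}(l)=1$ the following facts hold: (1) If $A(l,i(l))=0$, then: (a) $A(l,l)$ is equivalent to a standard idempotent $0,1$-matrix via identical permutations in rows and columns; (b) $A(i(l),i(l))_{kj}=\delta_{kj}$ for all $j$, whenever $A(l,l)_{kk}=0$. (2) If $A(l,i(l))\neq0$, then there is a twisting map $\psi\colon K^2\otimes K^n\to K^n\otimes K^2$ with $A_\psi(a,b)=A(f(a),f(b))$ for $a,b\in\{1,2\}$, where $f(1)=i(l)$ and $f(2)=l$.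
   Context: $K$ is a field, $m,n$ positive integers, $K^m,K^n$ product algebras with canonical bases $\{e_i\}$, $\{f_j\}$; $\mathbf 1$ is the all-ones column vector. For unital $K$-algebras $A,C$, a twisting map of $C$ with $A$ is a $K$-linear map $\chi\colon C\otimes A\to A\otimes C$ such that $\chi\circ(\eta_C\otimes A)=A\otimes\eta_C$, $\chi\circ(C\otimes\eta_A)=\eta_A\otimes C$, $\chi\circ(\mu_C\otimes A)=(A\otimes\mu_C)\circ(\chi\otimes C)\circ(C\otimes\chi)$ and $\chi\circ(C\otimes\mu_A)=(\mu_A\otimes C)\circ(A\otimes\chi)\circ(\chi\otimes A)$. For a linear map $\chi\colon K^m\otimes K^n\to K^n\otimes K^m$ write $\chi(e_i\otimes f_j)=\sum_{k,l}\lambda_{ij}^{kl}f_k\otimes e_l$, define $A_\chi(i,l)\in M_n(K)$ by $A_\chi(i,l)_{kj}=\lambda_{ij}^{kl}$, and put $\mathcal A_\chi=(A_\chi(i,l))_{i,l}$. A pre-twisting of $K^m$ with $K^n$ is a family $(A(i,l))_{1\le i,l\le m}$ of matrices in $M_n(K)$ with $A(i,l)A(i',l)=\delta_{ii'}A(i,l)$, $A(i,l)\mathbf 1=\delta_{il}\mathbf 1$ and $\sum_{i=1}^mA(i,l)=\mathrm{id}$ for all $i,i',l$. The reduced rank $\operatorname{rrank}_{\mathcal A}(l)$ is the number of indices $i\ne l$ with $A(i,l)\ne0$. A $0,1$-matrix $A\in M_n(K)$ is a standard idempotent $0,1$-matrix if there are $r\in\{1,\dots,n\}$ and a matrix $C\in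 M_{(n-r)\times r}(K)$ with exactly one non-zero entry in each row such that $A=\begin{pmatrix}\mathrm{id}_r&0\\C&0\end{pmatrix}$. Matrices $A,A'\in M_n(K)$ are equivalent via identical permutations in rows and columns if there is a permutation $\sigma\in S_n$ with $A_{\sigma(k)\sigma(j)}=A'_{kj}$ for all $k,j$. *)

theory Defs
  imports "HOL-Analysis.Analysis"
begin

text \<open>
  The product algebra \<open>K\<^sup>m\<close> is the type \<^typ>\<open>'k ^ 'm\<close> for a field \<open>'k\<close>, with the componentwise
  \<open>*\<close> and \<open>1\<close> of the library; its canonical basis consists of the vectors \<open>axis i 1\<close>.

  The tensor product of the coordinate spaces \<open>K\<^sup>a\<close> and \<open>K\<^sup>b\<close> is the coordinate space indexed
  by the product of the index types; \<open>axis i 1 \<otimes> axis j 1\<close> is its basis vector \<open>axis (i, j) 1\<close>.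
\<close>

definition tensor :: "'k::field ^ 'a \<Rightarrow> 'k ^ 'b \<Rightarrow> 'k ^ ('a \<times> 'b)" where
  "tensor v w = (\<chi> p. v $ fst p * w $ snd p)"

definition tensor_map ::
    "('k::field ^ 'a \<Rightarrow> 'k ^ 'c) \<Rightarrow> ('k ^ 'b \<Rightarrow> 'k ^ 'd) \<Rightarrow> 'k ^ ('a \<times> 'b) \<Rightarrow> 'k ^ ('c \<times> 'd)" where
  "tensor_map F G t =
     (\<Sum>i\<in>UNIV. \<Sum>j\<in>UNIV. t $ (i, j) *s tensor (F (axis i 1)) (G (axis j 1)))"

text \<open>The canonical isomorphism from \<open>(U \<otimes> V) \<otimes> W\<close> to \<open>U \<otimes> (V \<otimes> W)\<close> and its inverse.\<close>

definition assoc :: "'k::field ^ (('a::finite \<times> 'b::finite) \<times> 'c::finite) \<Rightarrow> 'k ^ ('a \<times> ('b \<times> 'c))" where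
  "assoc t = (\<chi> p. t $ ((fst p, fst (snd p)), snd (snd p)))"

definition assoc_inv :: "'k::field ^ ('a::finite \<times> ('b::finite \<times> 'c::finite)) \<Rightarrow> 'k ^ (('a \<times> 'b) \<times> 'c)" where
  "assoc_inv t = (\<chi> p. t $ (fst (fst p), (snd (fst p), snd p)))"

text \<open>The linear map \<open>\<mu>: V \<otimes> V \<rightarrow> V\<close> induced by a bilinear product on \<open>V\<close>.\<close>

definition mult_map ::
    "('k::field ^ 'a \<Rightarrow> 'k ^ 'a \<Rightarrow> 'k ^ 'a) \<Rightarrow> 'k ^ ('a \<times> 'a) \<Rightarrow> 'k ^ 'a" where
  "mult_map p t = (\<Sum>i\<in>UNIV. \<Sum>j\<in>UNIV. t $ (i, j) *s p (axis i 1) (axis j 1))"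

text \<open>
  Twisting maps of \<open>C\<close> with \<open>A\<close>, for unital algebras on coordinate spaces given by their units
  \<open>uC\<close>, \<open>uA\<close> and bilinear products \<open>pC\<close>, \<open>pA\<close>. Under the canonical identification
  of \<open>K \<otimes> V\<close> and \<open>V \<otimes> K\<close> with \<open>V\<close>, the map \<open>\<eta>\<^sub>C \<otimes> A\<close> sends \<open>a\<close> to \<open>tensor uC a\<close>,
  and similarly for the other unit maps.
\<close>

definition twisting_map ::
    "'k::field ^ 'c \<Rightarrow> ('k ^ 'c \<Rightarrow> 'k ^ 'c \<Rightarrow> 'k ^ 'c) \<Rightarrow>
     'k ^ 'a \<Rightarrow> ('k ^ 'a \<Rightarrow> 'k ^ 'a \<Rightarrow> 'k ^ 'a) \<Rightarrow>
     ('k ^ ('c \<times> 'a) \<Rightarrow> 'k ^ ('a \<times> 'c)) \<Rightarrow> bool" where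
  "twisting_map uC pC uA pA X \<longleftrightarrow>
     Vector_Spaces.linear (*s) (*s) X \<and>
     (\<forall>a. X (tensor uC a) = tensor a uC) \<and>
     (\<forall>c. X (tensor c uA) = tensor uA c) \<and>
     X \<circ> tensor_map (mult_map pC) id =
       tensor_map id (mult_map pC) \<circ> assoc \<circ> tensor_map X id \<circ> assoc_inv \<circ> tensor_map id X \<circ> assoc \<and>
     X \<circ> tensor_map id (mult_map pA) =
       tensor_map (mult_map pA) id \<circ> assoc_inv \<circ> tensor_map id X \<circ> assoc \<circ> tensor_map X id \<circ> assoc_inv"

abbreviation product_twisting_map ::
    "('k::field ^ ('m::finite \<times> 'n::finite) \<Rightarrow> 'k ^ ('n \<times> 'm)) \<Rightarrow> bool" where
  "product_twisting_map \<equiv> twisting_map 1 (*) 1 (*)"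

text \<open>The matrices \<open>A\<^sub>X(i,l)\<close>: the entry \<open>(k, j)\<close> is the coefficient of
  \<open>f\<^sub>k \<otimes> e\<^sub>l\<close> in \<open>X (e\<^sub>i \<otimes> f\<^sub>j)\<close>.\<close>

definition twisting_matrix ::
    "('k::field ^ ('m::finite \<times> 'n::finite) \<Rightarrow> 'k ^ ('n \<times> 'm)) \<Rightarrow> 'm \<Rightarrow> 'm \<Rightarrow> 'k ^ 'n ^ 'n" where
  "twisting_matrix X i l = (\<chi> k j. X (tensor (axis i 1) (axis j 1)) $ (k, l))"

text \<open>Here \<open>1\<close> is the all-ones vector, whereas the identity matrix is \<open>mat 1\<close>.\<close>

definition pre_twisting :: "('m::finite \<Rightarrow> 'm \<Rightarrow> 'k::field ^ 'n ^ 'n) \<Rightarrow> bool" where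
  "pre_twisting A \<longleftrightarrow>
     (\<forall>i i' l. A i l ** A i' l = (if i = i' then A i l else 0)) \<and>
     (\<forall>i l. A i l *v 1 = (if i = l then 1 else 0)) \<and>
     (\<forall>l. (\<Sum>i\<in>UNIV. A i l) = mat 1)"

definition rrank :: "('m::finite \<Rightarrow> 'm \<Rightarrow> 'k::field ^ 'n ^ 'n) \<Rightarrow> 'm \<Rightarrow> nat" where
  "rrank A l = card {i. i \<noteq> l \<and> A i l \<noteq> 0}"

text \<open>The index type \<open>'n\<close> of a matrix in block form is linearly ordered; \<open>pos k\<close> is the number in
  \<open>{1..CARD('n)}\<close> corresponding to \<open>k\<close>.\<close>

definition pos :: "'n::{finite,linorder} \<Rightarrow> nat" where
  "pos k = card {j. j \<le> k}"

text \<open>The block matrix with upper blocks \<open>id\<^sub>r\<close>, \<open>0\<close> and lower blocks \<open>C\<close>, \<open>0\<close>, where \<open>C\<close> has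
  rows \<open>1, \<dots>, n - r\<close> and columns \<open>1, \<dots>, r\<close>.\<close>

definition standard_block :: "nat \<Rightarrow> (nat \<Rightarrow> nat \<Rightarrow> 'k) \<Rightarrow> 'k::field ^ ('n::{finite,linorder}) ^ ('n::{finite,linorder})" where
  "standard_block r C =
     (\<chi> k j. if pos j \<le> r
             then (if pos k \<le> r then (if k = j then 1 else 0) else C (pos k - r) (pos j))
             else 0)"

definition standard_idempotent_01 :: "'k::field ^ ('n::{finite,linorder}) ^ ('n::{finite,linorder}) \<Rightarrow> bool" where
  "standard_idempotent_01 A \<longleftrightarrow>
     (\<forall>k j. A $ k $ j \<in> {0, 1}) \<and>
     (\<exists>r\<in>{1..CARD('n)}. \<exists>C.
        (\<forall>a\<in>{1..CARD('n) - r}. \<exists>!b. b \<in> {1..r} \<and> C a b \<noteq> 0) \<and> A = standard_block r C)"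

definition perm_equivalent :: "'k ^ 'n ^ 'n \<Rightarrow> 'k ^ 'n ^ 'n::finite \<Rightarrow> bool" where
  "perm_equivalent A A' \<longleftrightarrow>
     (\<exists>\<sigma>. \<sigma> permutes UNIV \<and> (\<forall>k j. A $ \<sigma> k $ \<sigma> j = A' $ k $ j))"

end

theory Submission
  imports Defs
begin

text \<open>
  In coordinates, the two unit axioms and the multiplicativity of a twisting map in the first
  factor say exactly that its matrices form a pre-twisting. Multiplicativity in the second factor
  says that
  \<open>\<Sum>s. A i s $ k $ j * A s l $ k $ j' = (if j = j' then A i l $ k $ j else 0)\<close> for all indices. For fixed \<open>l\<close> this is a
  condition on the columns \<open>s\<close> with \<open>A(s,l) \<noteq> 0\<close>, called multiplicativity at \<open>l\<close> below. So a
  pre-twisting comes from a twisting map iff it is multiplicative at every \<open>l\<close>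
  (\<open>ex_product_twisting_map_iff\<close>), and the theorem can be checked one column at a time.

  If the reduced rank at \<open>l\<close> is \<open>0\<close>, then \<open>A(l,l)\<close> is the identity and the condition is void.
  If it is \<open>1\<close>, put \<open>p = i(l)\<close>; then \<open>A(p,l) = id - A(l,l)\<close> and the sum has only the terms
  \<open>s = l\<close> and \<open>s = p\<close>.

  When \<open>A(l,p) = 0\<close>, the equation for \<open>i = l\<close> makes the entries of each row of \<open>A(l,l)\<close> orthogonal
  idempotents of the field. As each row sums to \<open>1\<close>, it contains a single \<open>1\<close>; hence \<open>A(l,l)\<close> is the matrix
  of a map \<open>g\<close> on the index set, and \<open>g \<circ> g = g\<close> because \<open>A(l,l)\<close> is idempotent. The equation for
  \<open>i = p\<close> forces row \<open>k\<close> of \<open>A(p,p)\<close> to be that of the identity whenever \<open>g k \<noteq> k\<close>, and the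
  remaining equations follow (\<open>multiplicative_at_iff_function_matrix\<close>). Listing the fixed points
  of \<open>g\<close> first turns its matrix into a standard idempotent \<open>0,1\<close>-matrix, and conversely
  (\<open>perm_equivalent_standard_iff\<close>).

  When \<open>A(l,p) \<noteq> 0\<close>, also \<open>i(p) = l\<close>, so the columns \<open>l\<close> and \<open>p\<close> are supported on \<open>{l, p}\<close>.
  Such a closed set of indices carries a pre-twisting of its own, which is multiplicative at its
  columns iff \<open>A\<close> is (\<open>multiplicative_at_restrict_iff\<close>).
\<close>

section \<open>Twisting maps in coordinates\<close>

text \<open>
  The axiom for the multiplication of \<open>K\<^sup>n\<close>, applied to \<open>e i \<otimes> f j \<otimes> f j'\<close> for the canonical
  basis vectors \<open>e\<close> of \<open>K\<^sup>m\<close> and \<open>f\<close> of \<open>K\<^sup>n\<close>, and read off at the coefficient of \<open>f k \<otimes> e l\<close>.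
\<close>

definition multiplicative_at :: "('m::finite \<Rightarrow> 'm \<Rightarrow> 'k::field ^ 'n ^ 'n) \<Rightarrow> 'm \<Rightarrow> bool" where
  "multiplicative_at A l \<longleftrightarrow>
     (\<forall>i k j j'. (\<Sum>s\<in>UNIV. A i s $ k $ j * A s l $ k $ j') = (if j = j' then A i l $ k $ j else 0))"

lemma sum_axis_mult:
  "(\<Sum>p\<in>UNIV. axis q (1::'k::field) $ p * F p) = F (q::'a::finite)"
proof -
  have "(\<Sum>p\<in>UNIV. axis q (1::'k) $ p * F p) = (\<Sum>p\<in>UNIV. if p = q then F p else 0)"
    by (intro sum.cong) (auto simp: axis_def)
  then show ?thesis by simp
qed

lemma sum_mult_axis:
  "(\<Sum>p\<in>UNIV. F p * axis p (1::'k::field) $ q) = F (q::'a::finite)"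
proof -
  have "(\<Sum>p\<in>UNIV. F p * axis p (1::'k) $ q) = (\<Sum>p\<in>UNIV. if p = q then F p else 0)"
    by (intro sum.cong) (auto simp: axis_def)
  then show ?thesis by simp
qed

lemma vec_sum_axis: "(t::'k::field ^ 'a::finite) = (\<Sum>p\<in>UNIV. t $ p *s axis p 1)"
  by (simp add: vec_eq_iff sum_mult_axis)

lemma linear_nth:
  fixes X :: "'k::field ^ 'a::finite \<Rightarrow> 'k ^ 'b::finite"
  assumes "Vector_Spaces.linear (*s) (*s) X"
  shows "X t $ q = (\<Sum>p\<in>UNIV. t $ p * X (axis p 1) $ q)"
proof -
  interpret Vector_Spaces.linear "(*s)" "(*s)" X by fact
  have "X t = X (\<Sum>p\<in>UNIV. t $ p *s axis p 1)" by (subst vec_sum_axis) simp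
  also have "\<dots> = (\<Sum>p\<in>UNIV. t $ p *s X (axis p 1))" by (simp add: sum scale)
  finally show ?thesis by simp
qed

lemma sum_prod_UNIV:
  "(\<Sum>p\<in>UNIV. F p) = (\<Sum>a\<in>UNIV. \<Sum>b\<in>UNIV. F (a::'a::finite, b::'b::finite))"
  by (simp add: UNIV_Times_UNIV[symmetric] sum.cartesian_product del: UNIV_Times_UNIV)

lemma tensor_axis: "tensor (axis i 1) (axis j 1) = (axis (i, j) 1 :: 'k::field ^ ('a::finite \<times> 'b::finite))"
  by (auto simp: tensor_def vec_eq_iff axis_def)

lemma tensor_map_left_nth:
  fixes F :: "'k::field ^ 'a::finite \<Rightarrow> 'k ^ 'c::finite" and t :: "'k ^ ('a \<times> 'b::finite)"
  shows "tensor_map F id t $ (q, c) = (\<Sum>p\<in>UNIV. t $ (p, c) * F (axis p 1) $ q)"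
proof -
  have "tensor_map F id t $ (q, c)
      = (\<Sum>p\<in>UNIV. \<Sum>j\<in>UNIV. (t $ (p, j) * F (axis p 1) $ q) * axis j 1 $ c)"
    by (simp add: tensor_map_def tensor_def mult.assoc)
  then show ?thesis by (simp only: sum_mult_axis)
qed

lemma tensor_map_right_nth:
  fixes G :: "'k::field ^ 'b::finite \<Rightarrow> 'k ^ 'd::finite" and t :: "'k ^ ('a::finite \<times> 'b)"
  shows "tensor_map id G t $ (a, q) = (\<Sum>p\<in>UNIV. t $ (a, p) * G (axis p 1) $ q)"
proof -
  have "tensor_map id G t $ (a, q)
      = (\<Sum>p\<in>UNIV. \<Sum>j\<in>UNIV. (t $ (j, p) * G (axis p 1) $ q) * axis j 1 $ a)"
    unfolding tensor_map_def tensor_def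
    by (subst sum.swap) (simp add: mult_ac)
  then show ?thesis by (simp only: sum_mult_axis)
qed

lemma mult_map_nth:
  fixes t :: "'k::field ^ ('a::finite \<times> 'a)"
  shows "mult_map (*) t $ c = t $ (c, c)"
proof -
  have "mult_map (*) t $ c = (\<Sum>i\<in>UNIV. (\<Sum>j\<in>UNIV. (t $ (i, j) * axis i 1 $ c) * axis j 1 $ c))"
    by (simp add: mult_map_def mult.assoc)
  then show ?thesis by (simp only: sum_mult_axis)
qed

lemma tensor_map_mult_left_nth:
  fixes t :: "'k::field ^ (('a::finite \<times> 'a) \<times> 'b::finite)"
  shows "tensor_map (mult_map (*)) id t $ (c, d) = t $ ((c, c), d)"
proof -
  have "tensor_map (mult_map (*)) id t $ (c, d)
      = (\<Sum>p\<in>UNIV. axis (c, c) 1 $ p * t $ (p, d))"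
    by (auto simp: tensor_map_left_nth mult_map_nth axis_def intro!: sum.cong)
  then show ?thesis by (simp only: sum_axis_mult)
qed

lemma tensor_map_mult_right_nth:
  fixes t :: "'k::field ^ ('b::finite \<times> ('a::finite \<times> 'a))"
  shows "tensor_map id (mult_map (*)) t $ (d, c) = t $ (d, (c, c))"
proof -
  have "tensor_map id (mult_map (*)) t $ (d, c)
      = (\<Sum>p\<in>UNIV. axis (c, c) 1 $ p * t $ (d, p))"
    by (auto simp: tensor_map_right_nth mult_map_nth axis_def intro!: sum.cong)
  then show ?thesis by (simp only: sum_axis_mult)
qed

text \<open>
  Comparison of coefficients: each axiom of a twisting map equates two functions of \<open>t\<close> whose
  coordinates are linear forms in the coordinates of \<open>t\<close>.
\<close>

lemma sum_mult_eq_iff: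
  fixes F G :: "'a::finite \<Rightarrow> 'k::field"
  shows "(\<forall>t::'k ^ 'a. (\<Sum>p\<in>UNIV. t $ p * F p) = (\<Sum>p\<in>UNIV. t $ p * G p)) \<longleftrightarrow> F = G"
proof
  assume h: "\<forall>t::'k ^ 'a. (\<Sum>p\<in>UNIV. t $ p * F p) = (\<Sum>p\<in>UNIV. t $ p * G p)"
  show "F = G"
    using h[rule_format, of "axis _ 1"] by (intro ext) (simp add: sum_axis_mult)
qed simp

context
  fixes X :: "'k::field ^ ('m::finite \<times> 'n::finite) \<Rightarrow> 'k ^ ('n \<times> 'm)"
    and A :: "'m \<Rightarrow> 'm \<Rightarrow> 'k ^ 'n ^ 'n"
  assumes lin: "Vector_Spaces.linear (*s) (*s) X"
  defines "A \<equiv> twisting_matrix X"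
begin

lemma basis_image_nth: "X (axis (i, j) 1) $ (k, l) = A i l $ k $ j"
  by (simp add: A_def twisting_matrix_def tensor_axis)

lemma image_nth: "X t $ (k, l) = (\<Sum>i\<in>UNIV. \<Sum>j\<in>UNIV. t $ (i, j) * A i l $ k $ j)"
  by (simp add: linear_nth[OF lin, of t] sum_prod_UNIV basis_image_nth)

lemma left_unit_iff: "(\<forall>a. X (tensor 1 a) = tensor a 1) \<longleftrightarrow> (\<forall>l. (\<Sum>i\<in>UNIV. A i l) = mat 1)"
proof -
  have "X (tensor 1 a) = tensor a 1 \<longleftrightarrow>
      (\<forall>k l. (\<Sum>j\<in>UNIV. a $ j * (\<Sum>i\<in>UNIV. A i l $ k $ j)) = (\<Sum>j\<in>UNIV. a $ j * mat 1 $ k $ j))" for a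
  proof -
    have "(\<Sum>j\<in>UNIV. a $ j * mat 1 $ k $ j) = a $ k" for k
    proof -
      have "(\<Sum>j\<in>UNIV. a $ j * mat 1 $ k $ j) = (\<Sum>j\<in>UNIV. if j = k then a $ j else 0)"
        by (intro sum.cong) (auto simp: mat_def)
      then show ?thesis by simp
    qed
    moreover have "X (tensor 1 a) $ (k, l) = (\<Sum>j\<in>UNIV. a $ j * (\<Sum>i\<in>UNIV. A i l $ k $ j))" for k l
      by (simp add: image_nth tensor_def sum_distrib_left) (rule sum.swap)
    ultimately show ?thesis by (simp add: vec_eq_iff tensor_def)
  qed
  then have "(\<forall>a. X (tensor 1 a) = tensor a 1) \<longleftrightarrow>
      (\<forall>k l. \<forall>a::'k ^ 'n. (\<Sum>j\<in>UNIV. a $ j * (\<Sum>i\<in>UNIV. A i l $ k $ j)) = (\<Sum>j\<in>UNIV. a $ j * mat 1 $ k $ j))"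
    by auto
  then show ?thesis
    unfolding sum_mult_eq_iff by (auto simp: vec_eq_iff fun_eq_iff)
qed

lemma right_unit_iff: "(\<forall>c. X (tensor c 1) = tensor 1 c) \<longleftrightarrow> (\<forall>i l. A i l *v 1 = (if i = l then 1 else 0))"
proof -
  have "X (tensor c 1) = tensor 1 c \<longleftrightarrow>
      (\<forall>k l. (\<Sum>i\<in>UNIV. c $ i * (A i l *v 1) $ k) = (\<Sum>i\<in>UNIV. c $ i * axis l 1 $ i))" for c
  proof -
    have "(\<Sum>i\<in>UNIV. c $ i * axis l 1 $ i) = c $ l" for l
      using sum_axis_mult[of l "($) c"] by (simp add: mult.commute)
    moreover have "X (tensor c 1) $ (k, l) = (\<Sum>i\<in>UNIV. c $ i * (A i l *v 1) $ k)" for k l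
      by (simp add: image_nth tensor_def matrix_vector_mult_def sum_distrib_left)
    ultimately show ?thesis by (auto simp add: vec_eq_iff tensor_def)
  qed
  then have "(\<forall>c. X (tensor c 1) = tensor 1 c) \<longleftrightarrow>
      (\<forall>k l. \<forall>c::'k ^ 'm. (\<Sum>i\<in>UNIV. c $ i * (A i l *v 1) $ k) = (\<Sum>i\<in>UNIV. c $ i * axis l 1 $ i))"
    by auto
  then show ?thesis
    unfolding sum_mult_eq_iff by (auto simp: vec_eq_iff fun_eq_iff axis_def)
qed

text \<open>
  Different basis vectors of \<open>K\<^sup>m\<close> have product \<open>0\<close>, so both applications of \<open>X\<close> contribute with
  the same column index \<open>l\<close>, and the sum over the intermediate basis vector of \<open>K\<^sup>n\<close> is a matrix
  product.
\<close>

lemma left_mult_iff: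
  "X \<circ> tensor_map (mult_map (*)) id =
     tensor_map id (mult_map (*)) \<circ> assoc \<circ> tensor_map X id \<circ> assoc_inv \<circ> tensor_map id X \<circ> assoc
   \<longleftrightarrow> (\<forall>i i' l. A i l ** A i' l = (if i = i' then A i l else 0))" (is "?L = ?R \<longleftrightarrow> _")
proof -
  define F where "F k l = (\<lambda>((i, i'), j). if i = i' then A i l $ k $ j else 0)" for k l
  define G where "G k l = (\<lambda>((i, i'), j). (A i l ** A i' l) $ k $ j)" for k l
  have L: "?L t $ (k, l) = (\<Sum>p\<in>UNIV. t $ p * F k l p)" for t k l
  proof -
    have "?L t $ (k, l) = (\<Sum>i\<in>UNIV. \<Sum>j\<in>UNIV. t $ ((i, i), j) * A i l $ k $ j)"
      by (simp add: image_nth tensor_map_mult_left_nth)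
    also have "\<dots> = (\<Sum>i\<in>UNIV. \<Sum>i'\<in>UNIV. \<Sum>j\<in>UNIV. if i' = i then t $ ((i, i), j) * A i l $ k $ j else 0)"
      by (intro sum.cong refl, subst sum.swap) simp
    also have "\<dots> = (\<Sum>p\<in>UNIV. t $ p * F k l p)"
      by (simp only: sum_prod_UNIV, intro sum.cong refl) (auto simp: F_def)
    finally show ?thesis .
  qed
  have R: "?R t $ (k, l) = (\<Sum>p\<in>UNIV. t $ p * G k l p)" for t k l
  proof -
    have "?R t $ (k, l) = (\<Sum>i\<in>UNIV. \<Sum>k'\<in>UNIV.
        (\<Sum>i'\<in>UNIV. \<Sum>j\<in>UNIV. t $ ((i, i'), j) * A i' l $ k' $ j) * A i l $ k $ k')"
      unfolding o_apply tensor_map_mult_right_nth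
      by (simp add: tensor_map_left_nth tensor_map_right_nth
          assoc_def assoc_inv_def sum_prod_UNIV basis_image_nth)
    also have "\<dots> = (\<Sum>i\<in>UNIV. \<Sum>k'\<in>UNIV. \<Sum>i'\<in>UNIV. \<Sum>j\<in>UNIV.
        t $ ((i, i'), j) * (A i l $ k $ k' * A i' l $ k' $ j))"
      by (simp only: sum_distrib_right) (simp only: mult_ac)
    also have "\<dots> = (\<Sum>i\<in>UNIV. \<Sum>i'\<in>UNIV. \<Sum>k'\<in>UNIV. \<Sum>j\<in>UNIV.
        t $ ((i, i'), j) * (A i l $ k $ k' * A i' l $ k' $ j))"
      by (rule sum.cong[OF refl], rule sum.swap)
    also have "\<dots> = (\<Sum>i\<in>UNIV. \<Sum>i'\<in>UNIV. \<Sum>j\<in>UNIV. \<Sum>k'\<in>UNIV.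
        t $ ((i, i'), j) * (A i l $ k $ k' * A i' l $ k' $ j))"
      by (rule sum.cong[OF refl], rule sum.cong[OF refl], rule sum.swap)
    also have "\<dots> = (\<Sum>p\<in>UNIV. t $ p * G k l p)"
      by (simp only: sum_prod_UNIV) (simp add: G_def matrix_matrix_mult_def sum_distrib_left)
    finally show ?thesis .
  qed
  have "?L = ?R \<longleftrightarrow> (\<forall>k l t. ?L t $ (k, l) = ?R t $ (k, l))"
    unfolding fun_eq_iff vec_eq_iff split_paired_All by auto
  also have "\<dots> \<longleftrightarrow> (\<forall>k l. F k l = G k l)"
    unfolding L R sum_mult_eq_iff ..
  also have "\<dots> \<longleftrightarrow> (\<forall>i i' l. A i l ** A i' l = (if i = i' then A i l else 0))"
    by (auto simp: F_def G_def fun_eq_iff vec_eq_iff)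
  finally show ?thesis .
qed

text \<open>
  Here the product of \<open>K\<^sup>n\<close> forces the same row index \<open>k\<close> in both factors, while the
  intermediate basis vector of \<open>K\<^sup>m\<close>, with index \<open>s\<close>, is summed over.
\<close>

lemma right_mult_iff:
  "X \<circ> tensor_map id (mult_map (*)) =
     tensor_map (mult_map (*)) id \<circ> assoc_inv \<circ> tensor_map id X \<circ> assoc \<circ> tensor_map X id \<circ> assoc_inv
   \<longleftrightarrow> (\<forall>l. multiplicative_at A l)" (is "?L = ?R \<longleftrightarrow> _")
proof -
  define F where "F k l = (\<lambda>(i, (j, j')). if j = j' then A i l $ k $ j else 0)" for k l
  define G where "G k l = (\<lambda>(i, (j, j')). \<Sum>s\<in>UNIV. A i s $ k $ j * A s l $ k $ j')" for k l
  have L: "?L t $ (k, l) = (\<Sum>p\<in>UNIV. t $ p * F k l p)" for t k l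
  proof -
    have "?L t $ (k, l) = (\<Sum>i\<in>UNIV. \<Sum>j\<in>UNIV. t $ (i, (j, j)) * A i l $ k $ j)"
      by (simp add: image_nth tensor_map_mult_right_nth)
    also have "\<dots> = (\<Sum>i\<in>UNIV. \<Sum>j\<in>UNIV. \<Sum>j'\<in>UNIV. if j' = j then t $ (i, (j, j)) * A i l $ k $ j else 0)"
      by simp
    also have "\<dots> = (\<Sum>p\<in>UNIV. t $ p * F k l p)"
      by (simp only: sum_prod_UNIV, intro sum.cong refl) (auto simp: F_def)
    finally show ?thesis .
  qed
  have R: "?R t $ (k, l) = (\<Sum>p\<in>UNIV. t $ p * G k l p)" for t k l
  proof -
    have "?R t $ (k, l) = (\<Sum>s\<in>UNIV. \<Sum>j'\<in>UNIV.
        (\<Sum>i\<in>UNIV. \<Sum>j\<in>UNIV. t $ (i, (j, j')) * A i s $ k $ j) * A s l $ k $ j')"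
      unfolding o_apply tensor_map_mult_left_nth
      by (simp add: tensor_map_left_nth tensor_map_right_nth
          assoc_def assoc_inv_def sum_prod_UNIV basis_image_nth)
    also have "\<dots> = (\<Sum>s\<in>UNIV. \<Sum>j'\<in>UNIV. \<Sum>i\<in>UNIV. \<Sum>j\<in>UNIV.
        t $ (i, (j, j')) * (A i s $ k $ j * A s l $ k $ j'))"
      by (simp only: sum_distrib_right) (simp only: mult_ac)
    also have "\<dots> = (\<Sum>s\<in>UNIV. \<Sum>i\<in>UNIV. \<Sum>j'\<in>UNIV. \<Sum>j\<in>UNIV.
        t $ (i, (j, j')) * (A i s $ k $ j * A s l $ k $ j'))"
      by (rule sum.cong[OF refl], rule sum.swap)
    also have "\<dots> = (\<Sum>i\<in>UNIV. \<Sum>s\<in>UNIV. \<Sum>j'\<in>UNIV. \<Sum>j\<in>UNIV.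
        t $ (i, (j, j')) * (A i s $ k $ j * A s l $ k $ j'))"
      by (rule sum.swap)
    also have "\<dots> = (\<Sum>i\<in>UNIV. \<Sum>j'\<in>UNIV. \<Sum>s\<in>UNIV. \<Sum>j\<in>UNIV.
        t $ (i, (j, j')) * (A i s $ k $ j * A s l $ k $ j'))"
      by (rule sum.cong[OF refl], rule sum.swap)
    also have "\<dots> = (\<Sum>i\<in>UNIV. \<Sum>j'\<in>UNIV. \<Sum>j\<in>UNIV. \<Sum>s\<in>UNIV.
        t $ (i, (j, j')) * (A i s $ k $ j * A s l $ k $ j'))"
      by (rule sum.cong[OF refl], rule sum.cong[OF refl], rule sum.swap)
    also have "\<dots> = (\<Sum>i\<in>UNIV. \<Sum>j\<in>UNIV. \<Sum>j'\<in>UNIV. \<Sum>s\<in>UNIV.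
        t $ (i, (j, j')) * (A i s $ k $ j * A s l $ k $ j'))"
      by (rule sum.cong[OF refl], rule sum.swap)
    also have "\<dots> = (\<Sum>p\<in>UNIV. t $ p * G k l p)"
      by (simp only: sum_prod_UNIV) (simp add: G_def sum_distrib_left)
    finally show ?thesis .
  qed
  have "?L = ?R \<longleftrightarrow> (\<forall>k l t. ?L t $ (k, l) = ?R t $ (k, l))"
    unfolding fun_eq_iff vec_eq_iff split_paired_All by auto
  also have "\<dots> \<longleftrightarrow> (\<forall>k l. F k l = G k l)"
    unfolding L R sum_mult_eq_iff ..
  also have "\<dots> \<longleftrightarrow> (\<forall>k l. G k l = F k l)" by metis
  also have "\<dots> \<longleftrightarrow> (\<forall>l. multiplicative_at A l)"
    by (simp only: F_def G_def fun_eq_iff split_paired_All prod.case multiplicative_at_def) blast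
  finally show ?thesis .
qed

lemma product_twisting_map_iff:
  "product_twisting_map X \<longleftrightarrow> pre_twisting A \<and> (\<forall>l. multiplicative_at A l)"
  unfolding twisting_map_def pre_twisting_def
    left_unit_iff right_unit_iff left_mult_iff right_mult_iff
  using lin by blast

end

lemma linear_with_twisting_matrix:
  fixes A :: "'m::finite \<Rightarrow> 'm \<Rightarrow> 'k::field ^ 'n::finite ^ 'n"
  obtains X :: "'k ^ ('m \<times> 'n) \<Rightarrow> 'k ^ ('n \<times> 'm)"
  where "Vector_Spaces.linear (*s) (*s) X" "twisting_matrix X = A"
proof
  define X :: "'k ^ ('m \<times> 'n) \<Rightarrow> 'k ^ ('n \<times> 'm)" where
    "X t = (\<chi> q. \<Sum>p\<in>UNIV. t $ p * A (fst p) (snd q) $ fst q $ snd p)" for t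
  show "Vector_Spaces.linear (*s) (*s) X"
    by unfold_locales
      (simp_all add: X_def vec_eq_iff algebra_simps sum.distrib sum_distrib_left)
  show "twisting_matrix X = A"
    by (simp add: twisting_matrix_def X_def tensor_axis sum_axis_mult fun_eq_iff vec_eq_iff)
qed

lemma ex_product_twisting_map_iff:
  fixes A :: "'m::finite \<Rightarrow> 'm \<Rightarrow> 'k::field ^ 'n::finite ^ 'n"
  shows "(\<exists>X. product_twisting_map X \<and> twisting_matrix X = A) \<longleftrightarrow>
     pre_twisting A \<and> (\<forall>l. multiplicative_at A l)"
proof
  assume "\<exists>X. product_twisting_map X \<and> twisting_matrix X = A"
  then show "pre_twisting A \<and> (\<forall>l. multiplicative_at A l)"
    using product_twisting_map_iff by (auto simp: twisting_map_def)
next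
  assume "pre_twisting A \<and> (\<forall>l. multiplicative_at A l)"
  with linear_with_twisting_matrix[of A] show "\<exists>X. product_twisting_map X \<and> twisting_matrix X = A"
    by (metis product_twisting_map_iff)
qed

section \<open>Matrices of idempotent maps\<close>

definition function_matrix :: "('n \<Rightarrow> 'n) \<Rightarrow> 'k::field ^ 'n ^ 'n::finite" where
  "function_matrix g = (\<chi> k j. if j = g k then 1 else 0)"

lemma function_matrix_nth: "function_matrix g $ k $ j = (if j = g k then 1 else 0)"
  by (simp add: function_matrix_def)

lemma function_matrix_diagonal_eq_0:
  "function_matrix g $ k $ k = (0 :: 'k::field) \<longleftrightarrow> g k \<noteq> (k :: 'n::finite)"
  by (auto simp: function_matrix_nth)

lemma function_matrix_mult:
  "function_matrix g ** function_matrix h = (function_matrix (h \<circ> g) :: 'k::field ^ 'n ^ 'n::finite)"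
proof -
  have "(\<Sum>x\<in>UNIV. (if x = g k then 1 else 0) * (if j = h x then 1 else 0))
      = (\<Sum>x\<in>UNIV. if x = g k then if j = h x then 1 else (0::'k) else 0)" for k j
    by (intro sum.cong) auto
  then show ?thesis
    by (simp add: vec_eq_iff matrix_matrix_mult_def function_matrix_nth)
qed

lemma function_matrix_inject:
  "function_matrix g = (function_matrix h :: 'k::field ^ 'n ^ 'n::finite) \<longleftrightarrow> g = h"
proof
  assume eq: "function_matrix g = (function_matrix h :: 'k ^ 'n ^ 'n)"
  show "g = h"
  proof
    fix k
    have "function_matrix g $ k $ g k = (function_matrix h $ k $ g k :: 'k)" using eq by simp
    then show "g k = h k" by (simp add: function_matrix_nth split: if_splits)
  qed
qed simp

text \<open>
  In a field, orthogonal idempotents are \<open>0\<close> except for at most one, which is \<open>1\<close>; the row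
  sums exclude a zero row.
\<close>

lemma function_matrix_of_orthogonal_rows:
  fixes M :: "'k::field ^ 'n ^ 'n::finite"
  assumes orth: "\<And>k j j'. M $ k $ j * M $ k $ j' = (if j = j' then M $ k $ j else 0)"
    and rows: "M *v 1 = 1"
  obtains g where "M = function_matrix g"
proof -
  have "\<exists>j. M $ k $ j \<noteq> 0" for k
  proof (rule ccontr)
    assume "\<nexists>j. M $ k $ j \<noteq> 0"
    then have "(M *v 1) $ k = 0" by (simp add: matrix_vector_mult_def)
    then show False using rows by simp
  qed
  then obtain g where g: "\<And>k. M $ k $ g k \<noteq> 0" by metis
  have "M $ k $ g k = 1" for k using orth[of k "g k" "g k"] g[of k] by simp
  moreover have "M $ k $ j = 0" if "j \<noteq> g k" for k j using orth[of k j "g k"] g[of k] that by simp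
  ultimately have "M = function_matrix g" by (simp add: vec_eq_iff function_matrix_nth)
  then show ?thesis by (rule that)
qed

lemma bij_betw_pos: "bij_betw pos (UNIV :: 'n::{finite,linorder} set) {1..CARD('n)}"
proof -
  have "pos j < pos k" if "j < k" for j k :: 'n
    unfolding pos_def using that by (intro psubset_card_mono) (auto simp: less_le_not_le)
  then have inj: "inj (pos :: 'n \<Rightarrow> nat)"
    by (intro injI) (metis less_irrefl neqE)
  moreover have "range (pos :: 'n \<Rightarrow> nat) \<subseteq> {1..CARD('n)}"
  proof
    fix y assume "y \<in> range (pos :: 'n \<Rightarrow> nat)"
    then obtain k :: 'n where y: "y = card {j. j \<le> k}" by (auto simp: pos_def)
    have "card {k} \<le> y" unfolding y by (intro card_mono) auto
    moreover have "y \<le> CARD('n)" unfolding y by (intro card_mono) auto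
    ultimately show "y \<in> {1..CARD('n)}" by simp
  qed
  ultimately show ?thesis
    by (simp add: bij_betw_def card_image card_subset_eq)
qed

lemma card_pos_le:
  assumes "r \<le> CARD('n)"
  shows "card {k :: 'n::{finite,linorder}. pos k \<le> r} = r"
proof -
  have "pos ` {k :: 'n. pos k \<le> r} = {1..r}"
  proof -
    have "pos ` {k :: 'n. pos k \<le> r} = range (pos :: 'n \<Rightarrow> nat) \<inter> {..r}" by auto
    also have "\<dots> = {1..r}"
      using bij_betw_pos[where 'n = 'n] assms by (auto simp: bij_betw_def)
    finally show ?thesis .
  qed
  moreover have "inj_on pos {k :: 'n. pos k \<le> r}"
    using bij_betw_pos[where 'n = 'n] by (auto simp: bij_betw_def inj_on_def)
  ultimately show ?thesis using card_image by fastforce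
qed

text \<open>
  The map \<open>h\<close> fixes the first \<open>r\<close> indices and sends every other one to the position, among the first
  \<open>r\<close>, of the non-zero entry in its row of \<open>C\<close>; hence it is idempotent.
\<close>

lemma standard_idempotent_01_function_matrix:
  fixes S :: "'k::field ^ ('n::{finite,linorder}) ^ ('n::{finite,linorder})"
  assumes "standard_idempotent_01 S"
  obtains h where "h \<circ> h = h" "S = function_matrix h"
proof -
  obtain r C where r: "r \<in> {1..CARD('n)}"
    and C: "\<And>a. a \<in> {1..CARD('n) - r} \<Longrightarrow> \<exists>!b. b \<in> {1..r} \<and> C a b \<noteq> 0"
    and S: "S = standard_block r C" and S01: "\<And>k j. S $ k $ j \<in> {0, 1}"
    using assms unfolding standard_idempotent_01_def by blast
  have pos_le: "pos k \<in> {1..CARD('n)}" for k :: 'n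
    using bij_betw_pos[where 'n = 'n] by (auto simp: bij_betw_def)
  have pos_inj: "pos j = pos k \<Longrightarrow> j = k" for j k :: 'n
    using bij_betw_pos[where 'n = 'n] by (auto simp: bij_betw_def inj_on_def)
  have "\<exists>j. pos j \<le> r \<and> (pos k \<le> r \<longrightarrow> j = k) \<and> (\<forall>j'. S $ k $ j' = (if j' = j then 1 else 0))" for k
  proof (cases "pos k \<le> r")
    case True
    then show ?thesis by (auto simp: S standard_block_def)
  next
    case False
    then have "pos k - r \<in> {1..CARD('n) - r}" using pos_le[of k] by auto
    from C[OF this] obtain b where b: "b \<in> {1..r}" "C (pos k - r) b \<noteq> 0"
      and ub: "\<And>b'. b' \<in> {1..r} \<Longrightarrow> C (pos k - r) b' \<noteq> 0 \<Longrightarrow> b' = b" by blast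
    have "b \<in> pos ` (UNIV :: 'n set)"
      using b r bij_betw_pos[where 'n = 'n] by (auto simp: bij_betw_def)
    then obtain j :: 'n where j: "pos j = b" by auto
    have "S $ k $ j \<noteq> 0" using b False j by (auto simp: S standard_block_def)
    then have "S $ k $ j = 1" using S01[of k j] by simp
    moreover have "S $ k $ j' = 0" if "j' \<noteq> j" for j'
    proof (cases "pos j' \<le> r")
      case True
      then have "C (pos k - r) (pos j') = 0"
        using ub[of "pos j'"] pos_le[of j'] pos_inj[of j' j] j that by auto
      then show ?thesis using False by (simp add: S standard_block_def)
    qed (simp add: S standard_block_def)
    ultimately show ?thesis using j b False by (intro exI[of _ j]) auto
  qed
  then obtain h where h: "\<And>k. pos (h k) \<le> r" "\<And>k. pos k \<le> r \<Longrightarrow> h k = k"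
    "\<And>k j. S $ k $ j = (if j = h k then 1 else 0)" by metis
  show ?thesis
  proof
    show "h \<circ> h = h" using h by (simp add: fun_eq_iff)
    show "S = function_matrix h" using h by (simp add: vec_eq_iff function_matrix_nth)
  qed
qed

lemma ex_permutation_onto:
  fixes P F :: "'n::finite set"
  assumes "card P = card F"
  obtains \<sigma> where "\<sigma> permutes UNIV" "\<And>k. \<sigma> k \<in> F \<longleftrightarrow> k \<in> P"
proof -
  obtain u where u: "bij_betw u P F" using assms finite_same_card_bij by (metis finite)
  have "card (- P) = card (- F)" using assms by (simp add: Compl_eq_Diff_UNIV card_Diff_subset)
  then obtain v where v: "bij_betw v (- P) (- F)" using finite_same_card_bij by (metis finite)
  define \<sigma> where "\<sigma> k = (if k \<in> P then u k else v k)" for k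
  have 1: "bij_betw \<sigma> P F" using u by (subst bij_betw_cong[of _ _ u]) (auto simp: \<sigma>_def)
  have 2: "bij_betw \<sigma> (- P) (- F)" using v by (subst bij_betw_cong[of _ _ v]) (auto simp: \<sigma>_def)
  have "bij \<sigma>" using bij_betw_combine[OF 1 2] by simp
  then have "\<sigma> permutes UNIV" by (intro bij_imp_permutes) simp_all
  moreover have "\<sigma> k \<in> F \<longleftrightarrow> k \<in> P" for k
    using 1 2 by (cases "k \<in> P") (auto dest: bij_betwE)
  ultimately show ?thesis by (rule that)
qed

text \<open>
  The permutation places the fixed points of \<open>g\<close> first. As \<open>g\<close> takes its values among them, all columns
  after these vanish.
\<close>

lemma function_matrix_perm_equivalent_standard:
  fixes g :: "'n::{finite,linorder} \<Rightarrow> 'n"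
  assumes g: "g \<circ> g = g"
  shows "\<exists>S. standard_idempotent_01 S \<and> perm_equivalent (function_matrix g :: 'k::field ^ ('n::{finite,linorder}) ^ ('n::{finite,linorder})) S"
proof -
  have gg: "g (g k) = g k" for k using g by (metis comp_apply)
  define F where "F = {k. g k = k}"
  define r where "r = card F"
  (* an idempotent map has a fixed point, so that r is positive *)
  have "g undefined \<in> F" by (simp add: F_def gg)
  then have r: "r \<in> {1..CARD('n)}"
    by (auto simp: r_def Suc_le_eq card_gt_0_iff intro: card_mono)
  then have "card {k :: 'n. pos k \<le> r} = card F" using card_pos_le by (auto simp: r_def)
  then obtain \<sigma> where \<sigma>: "\<sigma> permutes UNIV" "\<And>k. g (\<sigma> k) = \<sigma> k \<longleftrightarrow> pos k \<le> r"
    using ex_permutation_onto[of "{k. pos k \<le> r}" F] by (auto simp: F_def)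
  define q where "q = inv (pos :: 'n \<Rightarrow> nat)"
  have inj: "inj (pos :: 'n \<Rightarrow> nat)" and range: "range (pos :: 'n \<Rightarrow> nat) = {1..CARD('n)}"
    using bij_betw_pos[where 'n = 'n] by (auto simp: bij_betw_def)
  have q: "q (pos k) = k" for k using inj by (simp add: q_def)
  have pos_q: "pos (q a) = a" if "a \<in> {1..CARD('n)}" for a
    using that range by (metis f_inv_into_f q_def)
  define C :: "nat \<Rightarrow> nat \<Rightarrow> 'k" where
    "C a b = (if \<sigma> (q b) = g (\<sigma> (q (a + r))) then 1 else 0)" for a b
  define S :: "'k ^ ('n::{finite,linorder}) ^ ('n::{finite,linorder})" where "S = standard_block r C"
  have S: "S $ k $ j = function_matrix g $ \<sigma> k $ \<sigma> j" for k j
  proof -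
    have inj\<sigma>: "\<sigma> j = \<sigma> k \<longleftrightarrow> j = k" using \<sigma>(1) by (metis permutes_inj injD)
    have "\<sigma> j \<noteq> g (\<sigma> k)" if "\<not> pos j \<le> r" using that \<sigma>(2)[of j] gg by metis
    moreover have "pos k - r + r = pos k" if "\<not> pos k \<le> r" using that by simp
    ultimately show ?thesis
      using \<sigma>(2)[of k] inj\<sigma> by (auto simp: S_def standard_block_def C_def q function_matrix_nth)
  qed
  have "\<exists>!b. b \<in> {1..r} \<and> C a b \<noteq> 0" if a: "a \<in> {1..CARD('n) - r}" for a
  proof -
    obtain j where j: "\<sigma> j = g (\<sigma> (q (a + r)))" using \<sigma>(1) by (metis permutes_surj surjD)
    have "pos j \<le> r" using \<sigma>(2)[of j] j gg by simp
    moreover have "pos j \<in> {1..CARD('n)}" using range by blast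
    moreover have "b = pos j" if "b \<in> {1..r}" "C a b \<noteq> 0" for b
    proof -
      have "\<sigma> (q b) = \<sigma> j" using that j by (simp add: C_def split: if_splits)
      then have "q b = j" using \<sigma>(1) by (metis permutes_inj injD)
      then show ?thesis using pos_q[of b] that r by auto
    qed
    ultimately show ?thesis using j by (intro ex1I[of _ "pos j"]) (auto simp: C_def q)
  qed
  moreover have "S $ k $ j \<in> {0, 1}" for k j by (simp add: S function_matrix_nth)
  ultimately have "standard_idempotent_01 S"
    unfolding standard_idempotent_01_def using r S_def by blast
  moreover have "perm_equivalent (function_matrix g) S"
    unfolding perm_equivalent_def using \<sigma>(1) S by auto
  ultimately show ?thesis by blast
qed

lemma perm_equivalent_standard_iff:
  fixes M :: "'k::field ^ ('n::{finite,linorder}) ^ ('n::{finite,linorder})"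
  shows "(\<exists>S. standard_idempotent_01 S \<and> perm_equivalent M S) \<longleftrightarrow>
     (\<exists>g. g \<circ> g = g \<and> M = function_matrix g)"
proof
  assume "\<exists>S. standard_idempotent_01 S \<and> perm_equivalent M S"
  then obtain S \<sigma> where "standard_idempotent_01 S" and \<sigma>: "\<sigma> permutes UNIV"
    and MS: "\<And>k j. M $ \<sigma> k $ \<sigma> j = S $ k $ j"
    unfolding perm_equivalent_def by blast
  then obtain h where h: "h \<circ> h = h" "S = function_matrix h"
    by (metis standard_idempotent_01_function_matrix)
  define g where "g = \<sigma> \<circ> h \<circ> inv \<sigma>"
  have inv: "inv \<sigma> (\<sigma> k) = k" "\<sigma> (inv \<sigma> k) = k" for k
    using \<sigma> by (simp_all add: permutes_inverses)
  have "g \<circ> g = g" using h(1) by (simp add: g_def fun_eq_iff inv)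
  moreover have "M $ k $ j = function_matrix g $ k $ j" for k j
  proof -
    have "inv \<sigma> j = h (inv \<sigma> k) \<longleftrightarrow> j = g k" using inv by (auto simp: g_def) (metis inv(2))
    then show ?thesis
      using MS[of "inv \<sigma> k" "inv \<sigma> j"] by (simp add: h(2) inv function_matrix_nth)
  qed
  then have "M = function_matrix g" by (simp add: vec_eq_iff)
  ultimately show "\<exists>g. g \<circ> g = g \<and> M = function_matrix g" by blast
qed (use function_matrix_perm_equivalent_standard in blast)

section \<open>Multiplicativity of a single column\<close>

lemma multiplicative_at_trivial:
  assumes "pre_twisting A" and supp: "\<And>s. s \<noteq> l \<Longrightarrow> A s l = 0"
  shows "multiplicative_at A l"
proof -
  have "(\<Sum>s\<in>UNIV. A s l) = (\<Sum>s\<in>{l}. A s l)"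
    by (rule sum.mono_neutral_right) (auto simp: supp)
  then have diag: "A l l = mat 1" using assms(1) by (simp add: pre_twisting_def)
  have "(\<Sum>s\<in>UNIV. A i s $ k $ j * A s l $ k $ j') = A i l $ k $ j * mat 1 $ k $ j'" for i k j j'
  proof -
    have "(\<Sum>s\<in>UNIV. A i s $ k $ j * A s l $ k $ j') = (\<Sum>s\<in>{l}. A i s $ k $ j * A s l $ k $ j')"
      by (rule sum.mono_neutral_right) (auto simp: supp)
    then show ?thesis by (simp add: diag)
  qed
  moreover have "A i l $ k $ j * mat 1 $ k $ j' = (if j = j' then A i l $ k $ j else 0)" for i k j j'
    using supp[of i] by (cases "i = l") (auto simp: diag mat_def)
  ultimately show ?thesis by (simp add: multiplicative_at_def)
qed

text \<open>
  The hypothesis \<open>A l p = 0\<close> removes the second term for \<open>i = l\<close> and leaves the orthogonality of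
  the row entries of \<open>A l l\<close>. The equations for \<open>i\<close> outside \<open>{l, p}\<close> say that row \<open>k\<close> of \<open>A i p\<close> is
  zero when \<open>g k \<noteq> k\<close>; this follows from row \<open>k\<close> of \<open>A p p\<close> being \<open>e\<^sub>k\<close> and \<open>A p p ** A i p = 0\<close>.
\<close>

lemma multiplicative_at_iff_function_matrix:
  fixes A :: "'m::finite \<Rightarrow> 'm \<Rightarrow> 'k::field ^ 'n::finite ^ 'n"
  assumes pre: "pre_twisting A" and "p \<noteq> l"
    and supp: "\<And>s. s \<noteq> l \<Longrightarrow> s \<noteq> p \<Longrightarrow> A s l = 0"
    and zero: "A l p = 0"
  shows "multiplicative_at A l \<longleftrightarrow>
     (\<exists>g. g \<circ> g = g \<and> A l l = function_matrix g \<and>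
        (\<forall>k. g k \<noteq> k \<longrightarrow> A p p $ k = axis k 1))"
proof -
  have mult: "A i s ** A i' s = (if i = i' then A i s else 0)"
    and unit: "A i s *v 1 = (if i = s then 1 else 0)"
    and total: "(\<Sum>i\<in>UNIV. A i s) = mat 1" for i i' s
    using pre by (auto simp: pre_twisting_def)
  have two: "(\<Sum>s\<in>UNIV. A i s $ k $ j * A s l $ k $ j')
      = A i l $ k $ j * A l l $ k $ j' + A i p $ k $ j * A p l $ k $ j'" for i k j j'
  proof -
    have "(\<Sum>s\<in>UNIV. A i s $ k $ j * A s l $ k $ j') = (\<Sum>s\<in>{l, p}. A i s $ k $ j * A s l $ k $ j')"
      by (rule sum.mono_neutral_right) (auto simp: supp)
    then show ?thesis using \<open>p \<noteq> l\<close> by simp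
  qed
  have "(\<Sum>s\<in>UNIV. A s l) = (\<Sum>s\<in>{l, p}. A s l)"
    by (rule sum.mono_neutral_right) (auto simp: supp)
  then have compl: "A p l = mat 1 - A l l"
    using total[of l] \<open>p \<noteq> l\<close> by (simp add: algebra_simps)
  show ?thesis
  proof
    assume m: "multiplicative_at A l"
    have orth: "A l l $ k $ j * A l l $ k $ j' = (if j = j' then A l l $ k $ j else 0)" for k j j'
      using m two[of l k j j'] by (simp add: multiplicative_at_def zero)
    moreover have "A l l *v 1 = 1" by (simp add: unit)
    ultimately obtain g where g: "A l l = function_matrix g"
      by (rule function_matrix_of_orthogonal_rows)
    have "g \<circ> g = g"
      using mult[of l l l] by (simp add: g function_matrix_mult function_matrix_inject)
    moreover have "A p p $ k = axis k 1" if "g k \<noteq> k" for k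
    proof -
      have "A p p $ k $ j = axis k 1 $ j" for j
      proof -
        (* the equation for i = p and j' = k, in which A l l has the entry 0 and A p l the entry 1 at (k, k) *)
        have "(if j = k then A p l $ k $ j else 0)
            = A p l $ k $ j * A l l $ k $ k + A p p $ k $ j * A p l $ k $ k"
          using m two[of p k j k] by (simp add: multiplicative_at_def)
        then show ?thesis
          using that by (auto simp: compl g function_matrix_nth mat_def axis_def split: if_splits)
      qed
      then show ?thesis by (simp add: vec_eq_iff)
    qed
    ultimately show "\<exists>g. g \<circ> g = g \<and> A l l = function_matrix g \<and>
        (\<forall>k. g k \<noteq> k \<longrightarrow> A p p $ k = axis k 1)"
      using g by blast
  next
    assume "\<exists>g. g \<circ> g = g \<and> A l l = function_matrix g \<and>
        (\<forall>k. g k \<noteq> k \<longrightarrow> A p p $ k = axis k 1)"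
    then obtain g where g: "A l l = function_matrix g"
      and row: "\<And>k. g k \<noteq> k \<Longrightarrow> A p p $ k = axis k 1" by blast
    have row0: "A i p $ k $ j = 0" if "g k \<noteq> k" "i \<noteq> p" for i k j
    proof -
      have "A i p $ k $ j = (A p p ** A i p) $ k $ j"
        using row[OF that(1)] by (simp add: matrix_matrix_mult_def sum_axis_mult)
      then show ?thesis using mult[of p p i] that(2) by simp
    qed
    have "A i l $ k $ j * A l l $ k $ j' + A i p $ k $ j * A p l $ k $ j'
        = (if j = j' then A i l $ k $ j else 0)" for i k j j'
    proof -
      consider "i = l" | "i = p" | "i \<noteq> l" "i \<noteq> p" by blast
      then show ?thesis
      proof cases
        case 1
        then show ?thesis by (auto simp: zero g function_matrix_nth)
      next
        case 2
        show ?thesis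
        proof (cases "g k = k")
          case True
          then show ?thesis by (auto simp: 2 compl g function_matrix_nth mat_def)
        next
          case False
          then show ?thesis
            using row[OF False] by (auto simp: 2 compl g function_matrix_nth mat_def axis_def)
        qed
      next
        case 3
        then show ?thesis
          using row0[of k i j] by (cases "g k = k") (auto simp: supp compl g function_matrix_nth mat_def)
      qed
    qed
    then show "multiplicative_at A l" by (simp add: multiplicative_at_def two)
  qed
qed

lemma sum_range_inj:
  assumes "inj f" and "\<And>s. s \<notin> range f \<Longrightarrow> F s = 0"
  shows "(\<Sum>s\<in>UNIV. F (s::'m::finite)) = (\<Sum>a\<in>UNIV. F (f (a::'c::finite)) :: 'b::comm_monoid_add)"
proof -
  have "(\<Sum>s\<in>UNIV. F s) = (\<Sum>s\<in>range f. F s)"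
    by (rule sum.mono_neutral_right) (auto simp: assms(2))
  then show ?thesis using assms(1) by (simp add: sum.reindex)
qed

lemma pre_twisting_restrict:
  assumes "pre_twisting A" "inj f" and closed: "\<And>s b. s \<notin> range f \<Longrightarrow> A s (f b) = 0"
  shows "pre_twisting (\<lambda>a b. A (f a) (f b))"
proof -
  have "(\<Sum>a\<in>UNIV. A (f a) (f b)) = (\<Sum>s\<in>UNIV. A s (f b))" for b
    using sum_range_inj[OF assms(2), of "\<lambda>s. A s (f b)"] closed by simp
  then show ?thesis
    using assms(1) inj_eq[OF assms(2)] by (simp add: pre_twisting_def)
qed

text \<open>
  Only indices \<open>s\<close> in the range of \<open>f\<close> contribute to the sum, and for \<open>i\<close> outside the range both
  sides vanish.
\<close>

lemma multiplicative_at_restrict_iff: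
  assumes "inj f" and closed: "\<And>s b. s \<notin> range f \<Longrightarrow> A s (f b) = 0"
  shows "multiplicative_at (\<lambda>a b. A (f a) (f b)) b \<longleftrightarrow> multiplicative_at A (f b)"
proof -
  have sum: "(\<Sum>s\<in>UNIV. A i s $ k $ j * A s (f b) $ k $ j')
      = (\<Sum>a\<in>UNIV. A i (f a) $ k $ j * A (f a) (f b) $ k $ j')" for i k j j'
    by (rule sum_range_inj[OF assms(1)]) (simp add: closed)
  show ?thesis
    unfolding multiplicative_at_def sum
  proof (intro iffI allI)
    fix i k j j'
    assume h: "\<forall>a k j j'. (\<Sum>s\<in>UNIV. A (f a) (f s) $ k $ j * A (f s) (f b) $ k $ j')
        = (if j = j' then A (f a) (f b) $ k $ j else 0)"
    show "(\<Sum>a\<in>UNIV. A i (f a) $ k $ j * A (f a) (f b) $ k $ j')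
        = (if j = j' then A i (f b) $ k $ j else 0)"
      using h by (cases "i \<in> range f") (auto simp: closed)
  qed simp
qed

section \<open>Pre-twistings of reduced rank at most one\<close>

theorem proposition6p2:
  fixes A :: "'m::finite \<Rightarrow> 'm \<Rightarrow> 'k::field ^ ('n::{finite,linorder}) ^ ('n::{finite,linorder})"
    and i :: "'m \<Rightarrow> 'm"
  assumes "pre_twisting A"
    and "\<And>l. rrank A l \<le> 1"
    and "\<And>l. rrank A l = 1 \<Longrightarrow> i l \<noteq> l \<and> A (i l) l \<noteq> 0"
  shows "(\<exists>X :: 'k ^ ('m \<times> 'n) \<Rightarrow> 'k ^ ('n \<times> 'm).
            product_twisting_map X \<and> twisting_matrix X = A) \<longleftrightarrow>
         (\<forall>l. rrank A l = 1 \<longrightarrow>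
            (A l (i l) = 0 \<longrightarrow>
               (\<exists>S. standard_idempotent_01 S \<and> perm_equivalent (A l l) S) \<and>
               (\<forall>k. A l l $ k $ k = 0 \<longrightarrow>
                  (\<forall>j. A (i l) (i l) $ k $ j = (if k = j then 1 else 0)))) \<and>
            (A l (i l) \<noteq> 0 \<longrightarrow>
               (\<exists>\<psi> :: 'k ^ (2 \<times> 'n) \<Rightarrow> 'k ^ ('n \<times> 2).
                  product_twisting_map \<psi> \<and>
                  (let f = (\<lambda>a::2. if a = 1 then i l else l)
                   in \<forall>a b. twisting_matrix \<psi> a b = A (f a) (f b)))))"
proof -
  note pre = assms(1)
  have supp: "A s l = 0" if "rrank A l = 1" "s \<noteq> l" "s \<noteq> i l" for s l
  proof (rule ccontr)
    assume "A s l \<noteq> 0"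
    then have "{s, i l} \<subseteq> {i. i \<noteq> l \<and> A i l \<noteq> 0}"
      using assms(3)[OF that(1)] that by auto
    from card_mono[OF _ this] have "card {s, i l} \<le> rrank A l" by (simp add: rrank_def)
    then show False using that by simp
  qed
  have rank0: "multiplicative_at A l" if "rrank A l \<noteq> 1" for l
  proof -
    have "rrank A l = 0" using assms(2)[of l] that by simp
    then have "A s l = 0" if "s \<noteq> l" for s using that by (auto simp: rrank_def)
    then show ?thesis by (rule multiplicative_at_trivial[OF pre])
  qed
  have case1: "multiplicative_at A l \<longleftrightarrow>
      (\<exists>S. standard_idempotent_01 S \<and> perm_equivalent (A l l) S) \<and>
      (\<forall>k. A l l $ k $ k = 0 \<longrightarrow> (\<forall>j. A (i l) (i l) $ k $ j = (if k = j then 1 else 0)))"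
    if "rrank A l = 1" "A l (i l) = 0" for l
  proof -
    have "multiplicative_at A l \<longleftrightarrow>
     (\<exists>g. g \<circ> g = g \<and> A l l = function_matrix g \<and>
        (\<forall>k. g k \<noteq> k \<longrightarrow> A (i l) (i l) $ k = axis k 1))"
      using assms(3)[OF that(1)] supp[OF that(1)] that(2)
      by (intro multiplicative_at_iff_function_matrix[OF pre]) simp_all
    also have "\<dots> \<longleftrightarrow> (\<exists>g. g \<circ> g = g \<and> A l l = function_matrix g) \<and>
      (\<forall>k. A l l $ k $ k = 0 \<longrightarrow> A (i l) (i l) $ k = axis k 1)"
      by (auto simp: function_matrix_diagonal_eq_0)
    finally have "multiplicative_at A l \<longleftrightarrow>
        (\<exists>g. g \<circ> g = g \<and> A l l = function_matrix g) \<and>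
        (\<forall>k. A l l $ k $ k = 0 \<longrightarrow> A (i l) (i l) $ k = axis k 1)" .
    moreover have "A (i l) (i l) $ k = axis k 1 \<longleftrightarrow>
        (\<forall>j. A (i l) (i l) $ k $ j = (if k = j then 1 else 0))" for k
      by (simp add: vec_eq_iff axis_def eq_commute[of k])
    ultimately show ?thesis
      by (simp only: perm_equivalent_standard_iff)
  qed
  have case2: "(\<exists>\<psi> :: 'k ^ (2 \<times> 'n) \<Rightarrow> 'k ^ ('n \<times> 2). product_twisting_map \<psi> \<and>
        (let f = (\<lambda>a::2. if a = 1 then i l else l)
         in \<forall>a b. twisting_matrix \<psi> a b = A (f a) (f b))) \<longleftrightarrow>
      multiplicative_at A l \<and> multiplicative_at A (i l)"
    if l: "rrank A l = 1" "A l (i l) \<noteq> 0" for l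
  proof -
    (* A nonzero A l (i l) forces i (i l) = l, so the two columns l and i l are closed
       under taking supports and can be cut out of the family. *)
    define f where "f = (\<lambda>a::2. if a = 1 then i l else l)"
    have il: "i l \<noteq> l" using assms(3)[OF l(1)] by blast
    then have "l \<in> {s. s \<noteq> i l \<and> A s (i l) \<noteq> 0}" using l(2) by auto
    then have "rrank A (i l) \<noteq> 0" by (auto simp: rrank_def)
    then have r: "rrank A (i l) = 1" using assms(2)[of "i l"] by simp
    then have ii: "i (i l) = l" using supp[OF r, of l] il l(2) by metis
    have inj: "inj f"
      using il by (simp add: inj_def forall_2 f_def)
    have f12: "f 1 = i l" "f 2 = l" by (simp_all add: f_def)
    have "range f = {i l, l}" using f12 by (simp add: UNIV_2)
    then have closed: "A s (f b) = 0" if "s \<notin> range f" for s b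
      using that supp[OF l(1), of s] supp[OF r, of s] ii by (auto simp: f_def)
    have "(\<exists>\<psi> :: 'k ^ (2 \<times> 'n) \<Rightarrow> 'k ^ ('n \<times> 2). product_twisting_map \<psi> \<and>
        (let f = (\<lambda>a::2. if a = 1 then i l else l)
         in \<forall>a b. twisting_matrix \<psi> a b = A (f a) (f b))) \<longleftrightarrow>
      (\<exists>\<psi>. product_twisting_map \<psi> \<and> twisting_matrix \<psi> = (\<lambda>a b. A (f a) (f b)))"
      by (simp add: Let_def f_def fun_eq_iff)
    also have "\<dots> \<longleftrightarrow> (\<forall>b. multiplicative_at A (f b))"
    proof -
      have "pre_twisting (\<lambda>a b. A (f a) (f b))"
        by (rule pre_twisting_restrict[OF pre inj closed])
      moreover have "multiplicative_at (\<lambda>a b. A (f a) (f b)) b \<longleftrightarrow> multiplicative_at A (f b)" for b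
        by (rule multiplicative_at_restrict_iff[where A = A, OF inj closed])
      ultimately show ?thesis by (simp only: ex_product_twisting_map_iff) simp
    qed
    also have "\<dots> \<longleftrightarrow> multiplicative_at A l \<and> multiplicative_at A (i l)"
      by (simp add: forall_2 f12 conj_commute)
    finally show ?thesis .
  qed
  (* Condition (2) at l also speaks of the column i l; since all columns are considered, the
     conjunction over l still amounts to multiplicativity at every column. *)
  show ?thesis (is "_ \<longleftrightarrow> ?R")
  proof -
    have combine: "(Z \<longrightarrow> P) \<and> (\<not> Z \<longrightarrow> Q) \<longleftrightarrow> M \<and> (\<not> Z \<longrightarrow> N)"
      if "Z \<Longrightarrow> M \<longleftrightarrow> P" "\<not> Z \<Longrightarrow> Q \<longleftrightarrow> M \<and> N" for Z P Q M N
      using that by blast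
    have "?R \<longleftrightarrow> (\<forall>l. rrank A l = 1 \<longrightarrow> multiplicative_at A l \<and>
        (A l (i l) \<noteq> 0 \<longrightarrow> multiplicative_at A (i l)))"
      by (intro all_cong1 imp_cong refl combine case1 case2)
    also have "\<dots> \<longleftrightarrow> (\<forall>l. multiplicative_at A l)"
      using rank0 by blast
    finally show ?thesis
      using pre by (simp only: ex_product_twisting_map_iff) simp
  qed
qed

end
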